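(* Let $d \ge 2$ and $\alpha > 0$. There exists a constant $\beta = \beta(d,\alpha) > 0$ such that for every positive integer $n$, every $n$-point set $P \subset \mathbb{R}^d$ in general position with $\operatorname{diam}(P) < \alpha \sqrt[d]{n}$ contains a convex independent subset $Q$ with $|Q| \ge \beta n^{\frac{d-1}{d+1}}$.
   Context: For a finite set $P \subset \mathbb{R}^d$ with at least two points, the normalized diameter is $\operatorname{diam}(P) = \frac{\max\{|a-b| : a,b \in P, a \ne b\}}{\min\{|a-b| : a,b\in P, a \ne b\}}$, where $|\cdot|$ is Euclidean distance. A set is in general position if no $d+1$ of its points lie on a common affine hyperplane. A set $Q$ is convex independent if $Q$ is in general position and the points of $Q$ are the vertices of a convex polytope (i.e. no point of $Q$ lies in the convex hull of the others). *)

theory Defs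
  imports "HOL-Analysis.Analysis"
begin

text \<open>Only meaningful for finite sets with at least two points: on smaller sets the maximum and
  minimum range over the empty set and are unspecified.\<close>

definition normalized_diameter :: "'a::metric_space set \<Rightarrow> real" where
  "normalized_diameter P =
     Max {dist a b | a b. a \<in> P \<and> b \<in> P \<and> a \<noteq> b} /
     Min {dist a b | a b. a \<in> P \<and> b \<in> P \<and> a \<noteq> b}"

definition general_position :: "'a::euclidean_space set \<Rightarrow> bool" where
  "general_position P \<longleftrightarrow>
     \<not> (\<exists>S c r. S \<subseteq> P \<and> card S = DIM('a) + 1 \<and> c \<noteq> 0 \<and> S \<subseteq> {x. c \<bullet> x = r})"

definition convex_independent :: "'a::euclidean_space set \<Rightarrow> bool" where
  "convex_independent Q \<longleftrightarrow>
     finite Q \<and> general_position Q \<and> (\<forall>q\<in>Q. q \<notin> convex hull (Q - {q}))"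

end

theory Submission imports Defs begin

text \<open>
  Rescale so that the minimal distance is \<open>1\<close>; then \<open>P\<close> lies in a ball of radius of order
  \<open>r = n\<^bsup>1/d\<^esup>\<close>. Take a paraboloid with curvature radius \<open>r\<close> and, over a grid of
  \<open>N\<close>, of order \<open>(r / a)\<^bsup>d - 1\<^esup>\<close>, points, small disjoint caps of width \<open>a\<close> and height
  \<open>h = d a\<^sup>2 / r\<close>, where \<open>a\<^bsup>d + 1\<^esup> = \<epsilon> r\<close> makes the volume of a cap a small constant.
  Points chosen one from each nonempty cap are in convex position, since the plane bounding a cap
  separates it from all others. So it suffices to find a translate of the configuration for which a
  positive fraction of the caps meets \<open>P\<close>.

  By averaging, this follows from a second moment bound: for points \<open>p \<noteq> q\<close>, each row of the grid in
  a suitable coordinate direction has only \<open>O(a / |p - q|)\<close> caps whose normal is orthogonal enough to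
  \<open>p - q\<close> for one translate to contain both points, and the sum of \<open>1 / |p - q|\<close> over all \<open>q\<close> at
  distance \<open>O(a)\<close> is \<open>O(a\<^bsup>d - 1\<^esup>)\<close> because \<open>P\<close> is separated. Each cap contains a
  parallelepiped that tiles space by a lattice not depending on the cap, so the average can be taken
  over finitely many lattice translations.
\<close>

subsection \<open>Collisions and packing\<close>

text \<open>A fibre of size \<open>k\<close> contributes one value and \<open>k (k - 1)\<close>
  ordered collisions, and \<open>k \<le> 1 + k (k - 1)\<close> for \<open>k \<ge> 1\<close>.\<close>

lemma card_le_image_plus_collisions:
  assumes "finite P"
  shows "card P \<le> card (f ` P) + (\<Sum>p\<in>P. card {q\<in>P-{p}. f p = f q})"
  using assms
proof (induction P rule: finite_induct)
  case (insert x P)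
  have "(\<Sum>p\<in>P. card {q\<in>P-{p}. f p = f q}) \<le> (\<Sum>p\<in>P. card {q\<in>insert x P-{p}. f p = f q})"
    by (intro sum_mono card_mono) (use insert in auto)
  moreover have "Suc (card (f ` P)) \<le> card (f ` insert x P) + card {q\<in>insert x P-{x}. f x = f q}"
  proof (cases "f x \<in> f ` P")
    case True
    then have "{q\<in>insert x P-{x}. f x = f q} \<noteq> {}" using insert by auto
    then have "card {q\<in>insert x P-{x}. f x = f q} > 0" using insert by (simp add: card_gt_0_iff)
    moreover have "card (f ` insert x P) = card (f ` P)" using True by (simp add: insert_absorb)
    ultimately show ?thesis by linarith
  next
    case False
    then have "card (f ` insert x P) = Suc (card (f ` P))" using insert by simp
    then show ?thesis by linarith
  qed
  moreover have "(\<Sum>p\<in>insert x P. card {q\<in>insert x P-{p}. f p = f q})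
    = card {q\<in>insert x P-{x}. f x = f q} + (\<Sum>p\<in>P. card {q\<in>insert x P-{p}. f p = f q})"
    using insert by (intro sum.insert)
  moreover have "card (insert x P) = Suc (card P)" using insert.hyps by simp
  ultimately show ?case using insert.IH by linarith
qed simp

text \<open>For each index \<open>i\<close>, the map \<open>\<lambda>p. t p i\<close> takes at least
  \<open>card P\<close> values less its collisions. Summed over \<open>I\<close>, the hypothesis on
  pairs leaves at least half of \<open>card P * card I\<close> incidences between indices and
  attained values, and a most frequent value gets at least the average share.\<close>

lemma exists_value_attained_often:
  fixes t :: "'p \<Rightarrow> 'i \<Rightarrow> 't"
  assumes fin: "finite P" "finite I" "finite T"
    and t: "\<And>p i. p \<in> P \<Longrightarrow> i \<in> I \<Longrightarrow> t p i \<in> T"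
    and ne: "P \<noteq> {}" "I \<noteq> {}"
    and pairs: "(\<Sum>p\<in>P. \<Sum>q\<in>P-{p}. real (card {i\<in>I. t p i = t q i})) \<le> real (card P) * real (card I) / 2"
  obtains \<tau> where "\<tau> \<in> T"
    "real (card P) * real (card I) / 2 \<le> real (card {i\<in>I. \<exists>p\<in>P. t p i = \<tau>}) * real (card T)"
proof -
  define c where "c \<tau> = real (card {i\<in>I. \<exists>p\<in>P. t p i = \<tau>})" for \<tau>
  have "T \<noteq> {}" using t ne by blast
  have "\<exists>\<tau>\<in>T. \<forall>\<sigma>\<in>T. c \<sigma> \<le> c \<tau>"
  proof -
    have "Max (c ` T) \<in> c ` T" using fin \<open>T \<noteq> {}\<close> by (intro Max_in) auto
    then show ?thesis using fin by (metis (no_types, lifting) Max_ge finite_imageI imageE imageI)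
  qed
  then obtain \<tau> where \<tau>: "\<tau> \<in> T" "\<And>\<sigma>. \<sigma> \<in> T \<Longrightarrow> c \<sigma> \<le> c \<tau>" by blast
  have "real (card P) * real (card I) = (\<Sum>i\<in>I. real (card P))" by simp
  also have "\<dots> \<le> (\<Sum>i\<in>I. real (card ((\<lambda>p. t p i) ` P)) + (\<Sum>p\<in>P. real (card {q\<in>P-{p}. t p i = t q i})))"
  proof (rule sum_mono)
    fix i
    show "real (card P) \<le> real (card ((\<lambda>p. t p i) ` P)) + (\<Sum>p\<in>P. real (card {q\<in>P-{p}. t p i = t q i}))"
      using of_nat_mono[OF card_le_image_plus_collisions[OF fin(1), of "\<lambda>p. t p i"], where 'a=real] by simp
  qed
  also have "\<dots> = (\<Sum>i\<in>I. real (card ((\<lambda>p. t p i) ` P))) + (\<Sum>i\<in>I. \<Sum>p\<in>P. real (card {q\<in>P-{p}. t p i = t q i}))"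
    by (rule sum.distrib)
  \<comment> \<open>Double counting of the pairs (index, attained value).\<close>
  also have "(\<Sum>i\<in>I. real (card ((\<lambda>p. t p i) ` P))) = (\<Sum>\<tau>\<in>T. c \<tau>)"
  proof -
    have "real (card ((\<lambda>p. t p i) ` P)) = (\<Sum>\<tau>\<in>T. of_bool (\<exists>p\<in>P. t p i = \<tau>))" if "i \<in> I" for i
    proof -
      have "(\<lambda>p. t p i) ` P = {\<tau>\<in>T. \<exists>p\<in>P. t p i = \<tau>}" using t that by auto
      then show ?thesis using fin by (simp add: of_bool_def sum.If_cases Int_def)
    qed
    then have "(\<Sum>i\<in>I. real (card ((\<lambda>p. t p i) ` P))) = (\<Sum>i\<in>I. \<Sum>\<tau>\<in>T. of_bool (\<exists>p\<in>P. t p i = \<tau>))"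
      by (intro sum.cong) auto
    also have "\<dots> = (\<Sum>\<tau>\<in>T. \<Sum>i\<in>I. of_bool (\<exists>p\<in>P. t p i = \<tau>))" by (rule sum.swap)
    also have "\<dots> = (\<Sum>\<tau>\<in>T. c \<tau>)"
      using fin by (simp add: c_def of_bool_def sum.If_cases Int_def)
    finally show ?thesis .
  qed
  also have "\<dots> \<le> (\<Sum>\<sigma>\<in>T. c \<tau>)" by (intro sum_mono \<tau>)
  also have "(\<Sum>i\<in>I. \<Sum>p\<in>P. real (card {q\<in>P-{p}. t p i = t q i}))
     = (\<Sum>p\<in>P. \<Sum>q\<in>P-{p}. real (card {i\<in>I. t p i = t q i}))"
  proof -
    have "(\<Sum>i\<in>I. \<Sum>p\<in>P. real (card {q\<in>P-{p}. t p i = t q i}))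
      = (\<Sum>i\<in>I. \<Sum>p\<in>P. \<Sum>q\<in>P-{p}. of_bool (t p i = t q i))"
      using fin by (simp add: of_bool_def sum.If_cases Int_def)
    also have "\<dots> = (\<Sum>p\<in>P. \<Sum>q\<in>P-{p}. \<Sum>i\<in>I. of_bool (t p i = t q i))"
      by (subst sum.swap) (intro sum.cong refl sum.swap)
    also have "\<dots> = (\<Sum>p\<in>P. \<Sum>q\<in>P-{p}. real (card {i\<in>I. t p i = t q i}))"
      using fin by (simp add: of_bool_def sum.If_cases Int_def)
    finally show ?thesis .
  qed
  finally have "real (card P) * real (card I) / 2 \<le> c \<tau> * real (card T)"
    using pairs by (simp add: mult.commute)
  then show ?thesis using that \<tau>(1) unfolding c_def by blast
qed

text \<open>Pigeonhole on cubes of side \<open>1 / D\<close>: two points in one cube have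
  l1-distance below \<open>1\<close>, so separation allows only one. The ball meets at most
  \<open>2 * M + 1\<close> cubes per coordinate, and
  \<open>2 * M + 1 < 2 * D * t + 3 \<le> 5 * D * t\<close>.\<close>

lemma card_separated_ball_le:
  fixes P :: "(real^'d) set"
  assumes fin: "finite P" and sep: "\<And>p q. p \<in> P \<Longrightarrow> q \<in> P \<Longrightarrow> p \<noteq> q \<Longrightarrow> dist p q \<ge> 1"
    and t: "t \<ge> 1"
  shows "real (card {q\<in>P. dist p q \<le> t}) \<le> (5 * real CARD('d) * t) ^ CARD('d)"
proof -
  define D where "D = real CARD('d)"
  have D: "D \<ge> 1" unfolding D_def by (simp add: Suc_leI)
  define M where "M = \<lceil>D * t\<rceil>"
  define f where "f q = (\<lambda>j::'d. \<lfloor>D * (q $ j - p $ j)\<rfloor>)" for q :: "real^'d"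
  let ?S = "{q\<in>P. dist p q \<le> t}"
  have inj: "inj_on f ?S"
  proof (rule inj_onI, rule ccontr)
    fix q q' assume q: "q \<in> ?S" "q' \<in> ?S" and eq: "f q = f q'" and ne: "q \<noteq> q'"
    have "D * \<bar>q $ j - q' $ j\<bar> < 1" for j
    proof -
      have "\<lfloor>D * (q $ j - p $ j)\<rfloor> = \<lfloor>D * (q' $ j - p $ j)\<rfloor>" using eq unfolding f_def by meson
      then have "\<bar>D * (q $ j - p $ j) - D * (q' $ j - p $ j)\<bar> < 1" by linarith
      moreover have "D * (q $ j - p $ j) - D * (q' $ j - p $ j) = D * (q $ j - q' $ j)" by (simp add: algebra_simps)
      ultimately show ?thesis using D by (simp add: abs_mult)
    qed
    then have "(\<Sum>j\<in>UNIV. D * \<bar>q $ j - q' $ j\<bar>) < (\<Sum>j\<in>(UNIV::'d set). 1)"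
      by (intro sum_strict_mono) auto
    then have "D * (\<Sum>j\<in>UNIV. \<bar>q $ j - q' $ j\<bar>) < D" by (simp add: sum_distrib_left D_def)
    then have "(\<Sum>j\<in>UNIV. \<bar>(q - q') $ j\<bar>) < 1" using D by simp
    then have "dist q q' < 1" using norm_le_l1_cart[of "q - q'"] by (simp add: dist_norm)
    then show False using sep q ne by fastforce
  qed
  have "f ` ?S \<subseteq> PiE UNIV (\<lambda>_. {-M..M})"
  proof (clarsimp simp: PiE_def, rename_tac q j)
    fix q j assume "dist p q \<le> t"
    then have "\<bar>q $ j - p $ j\<bar> \<le> t"
      using component_le_norm_cart[of "q - p" j] by (simp add: dist_norm norm_minus_commute)
    then have "\<bar>D * (q $ j - p $ j)\<bar> \<le> D * t" using D by (simp add: abs_mult)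
    then show "- M \<le> f q j \<and> f q j \<le> M" unfolding f_def M_def by linarith
  qed
  then have "card (f ` ?S) \<le> card (PiE (UNIV::'d set) (\<lambda>_. {-M..M}))"
    by (intro card_mono finite_PiE) auto
  also have "\<dots> = nat (2 * M + 1) ^ CARD('d)" by (simp add: card_PiE)
  finally have "card ?S \<le> nat (2 * M + 1) ^ CARD('d)" by (simp add: card_image[OF inj])
  then have "real (card ?S) \<le> real (nat (2 * M + 1)) ^ CARD('d)"
    by (metis of_nat_le_iff of_nat_power)
  also have "\<dots> \<le> (5 * D * t) ^ CARD('d)"
  proof (rule power_mono)
    have "D * t \<ge> 1" using D t by (metis mult_mono' mult_1 zero_le_one)
    then show "real (nat (2 * M + 1)) \<le> 5 * D * t" unfolding M_def by linarith
  qed simp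
  finally show ?thesis by (simp add: D_def)
qed

lemma sum_power_le_twice_last:
  fixes b :: real
  assumes "b \<ge> 2"
  shows "(\<Sum>k\<le>n. b ^ k) \<le> 2 * b ^ n"
proof (induction n)
  case (Suc n)
  have "2 * b ^ n \<le> b * b ^ n" using assms by (intro mult_right_mono) auto
  then show ?case using Suc by simp
qed simp

text \<open>Dyadic decomposition: the ball of radius \<open>2 ^ k\<close> holds of order
  \<open>2 ^ (k d)\<close> points, so scale \<open>k\<close> contributes of order
  \<open>2 ^ (k (d - 1))\<close>. Since \<open>d \<ge> 2\<close> the ratio of this geometric sum is
  at least \<open>2\<close> and the top scale dominates.\<close>

lemma sum_inverse_dist_separated_le:
  fixes P :: "(real^'d) set"
  assumes d: "CARD('d) \<ge> 2"
    and fin: "finite P" and sep: "\<And>p q. p \<in> P \<Longrightarrow> q \<in> P \<Longrightarrow> p \<noteq> q \<Longrightarrow> dist p q \<ge> 1"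
    and p: "p \<in> P" and \<rho>: "\<rho> \<ge> 0"
  shows "(\<Sum>q\<in>{q\<in>P-{p}. dist p q \<le> \<rho>}. 1 / dist p q)
    \<le> 4 * (5 * real CARD('d)) ^ CARD('d) * (2 * \<rho>) ^ (CARD('d) - 1)"
proof (cases "\<rho> \<ge> 1")
  case False
  have "{q\<in>P-{p}. dist p q \<le> \<rho>} = {}" using sep p False by force
  then show ?thesis using \<rho> by (simp only: sum.empty) simp
next
  case True
  let ?d = "CARD('d)"
  let ?S = "{q\<in>P-{p}. dist p q \<le> \<rho>}"
  define M where "M = nat \<lceil>log 2 \<rho>\<rceil>"
  have l0: "log 2 \<rho> \<ge> 0" using True by simp
  have "real M \<le> log 2 \<rho> + 1" using l0 unfolding M_def by linarith
  then have "2 powr real M \<le> 2 powr (log 2 \<rho> + 1)" by (intro powr_mono) auto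
  also have "\<dots> = 2 * \<rho>" using True by (simp add: powr_add)
  finally have M2: "2 ^ M \<le> 2 * \<rho>" by (simp add: powr_realpow)
  have fS: "finite ?S" using fin by simp
  \<comment> \<open>The least \<open>k\<close> with \<open>s \<le> 2 ^ k\<close> also satisfies
    \<open>2 ^ k \<le> 2 * s\<close>, so its term alone dominates \<open>1 / s\<close>.\<close>
  have pt: "1 / s \<le> (\<Sum>k\<le>M. 2 / 2 ^ k * of_bool (s \<le> 2 ^ k))" if s: "1 \<le> s" "s \<le> \<rho>" for s :: real
  proof -
    define k where "k = nat \<lceil>log 2 s\<rceil>"
    have l0: "log 2 s \<ge> 0" using s by simp
    have "s = 2 powr log 2 s" using s by simp
    also have "\<dots> \<le> 2 powr real k" unfolding k_def by (intro powr_mono) (use l0 in linarith)+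
    finally have k1: "s \<le> 2 ^ k" by (simp add: powr_realpow)
    have "real k \<le> log 2 s + 1" using l0 unfolding k_def by linarith
    then have "2 powr real k \<le> 2 powr (log 2 s + 1)" by (intro powr_mono) auto
    also have "\<dots> = 2 * s" using s by (simp add: powr_add)
    finally have k2: "2 ^ k \<le> 2 * s" by (simp add: powr_realpow)
    have "log 2 s \<le> log 2 \<rho>" using s by simp
    then have "k \<le> M" unfolding k_def M_def by (intro nat_mono ceiling_mono)
    have "1 / s \<le> 2 / 2 ^ k * of_bool (s \<le> 2 ^ k)" using k1 k2 s by (simp add: field_simps)
    also have "\<dots> \<le> (\<Sum>k\<le>M. 2 / 2 ^ k * of_bool (s \<le> 2 ^ k))"
      by (rule member_le_sum) (use \<open>k \<le> M\<close> in auto)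
    finally show ?thesis .
  qed
  have "(\<Sum>q\<in>?S. 1 / dist p q) \<le> (\<Sum>q\<in>?S. \<Sum>k\<le>M. 2 / 2 ^ k * of_bool (dist p q \<le> 2 ^ k))"
    by (intro sum_mono pt) (use sep p in auto)
  also have "\<dots> = (\<Sum>k\<le>M. 2 / 2 ^ k * real (card {q\<in>?S. dist p q \<le> 2 ^ k}))"
  proof (subst sum.swap, rule sum.cong[OF refl])
    fix k
    have "(\<Sum>q\<in>?S. 2 / 2 ^ k * of_bool (dist p q \<le> 2 ^ k)) = (2::real) / 2 ^ k * (\<Sum>q\<in>?S. of_bool (dist p q \<le> 2 ^ k))"
      by (rule sum_distrib_left[symmetric])
    also have "(\<Sum>q\<in>?S. of_bool (dist p q \<le> 2 ^ k) :: real) = real (card {q\<in>?S. dist p q \<le> 2 ^ k})"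
      using fS by (subst sum_of_bool_eq) (simp_all add: Int_def)
    finally show "(\<Sum>q\<in>?S. 2 / 2 ^ k * of_bool (dist p q \<le> 2 ^ k)) = (2::real) / 2 ^ k * real (card {q\<in>?S. dist p q \<le> 2 ^ k})" .
  qed
  also have "\<dots> \<le> (\<Sum>k\<le>M. 2 / 2 ^ k * (5 * real ?d * 2 ^ k) ^ ?d)"
  proof (intro sum_mono mult_left_mono)
    fix k :: nat
    have "card {q\<in>?S. dist p q \<le> 2 ^ k} \<le> card {q\<in>P. dist p q \<le> 2 ^ k}"
      by (rule card_mono) (use fin in auto)
    also have "real (card {q\<in>P. dist p q \<le> 2 ^ k}) \<le> (5 * real ?d * 2 ^ k) ^ ?d"
      by (rule card_separated_ball_le) (use fin sep in auto)
    finally show "real (card {q\<in>?S. dist p q \<le> 2 ^ k}) \<le> (5 * real ?d * 2 ^ k) ^ ?d" by simp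
  qed simp
  also have "\<dots> = 2 * (5 * real ?d) ^ ?d * (\<Sum>k\<le>M. (2 ^ (?d - 1)) ^ k)"
  proof -
    obtain e where e: "?d = Suc e" using d by (cases ?d) auto
    have "2 / 2 ^ k * (5 * real ?d * 2 ^ k) ^ ?d = 2 * (5 * real ?d) ^ ?d * (2 ^ (?d - 1)) ^ k" for k
      unfolding power_mult_distrib by (simp add: e power_mult[symmetric] mult.commute)
    then show ?thesis by (simp add: sum_distrib_left)
  qed
  also have "\<dots> \<le> 2 * (5 * real ?d) ^ ?d * (2 * (2 ^ (?d - 1)) ^ M)"
  proof (intro mult_left_mono sum_power_le_twice_last)
    show "(2::real) \<le> 2 ^ (?d - 1)" using d power_increasing[of 1 "?d-1" "2::real"] by simp
  qed simp
  also have "(2 ^ (?d - 1)) ^ M = ((2::real) ^ M) ^ (?d - 1)" by (simp add: power_mult[symmetric] mult.commute)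
  also have "2 * (5 * real ?d) ^ ?d * (2 * (2 ^ M) ^ (?d - 1)) \<le> 2 * (5 * real ?d) ^ ?d * (2 * (2 * \<rho>) ^ (?d - 1))"
    by (intro mult_left_mono power_mono M2) auto
  finally show ?thesis by simp
qed

subsection \<open>Slabs under a paraboloid\<close>

text \<open>With the coordinate \<open>z\<close> as height, \<open>tilt z r x y\<close> is the height of \<open>y\<close> above the tangent plane of
  the paraboloid \<open>y\<^sub>z = - \<Sum>\<^sub>j y\<^sub>j\<^sup>2 / (2 r)\<close> at the point over \<open>x\<close>. The value \<open>x z\<close> is ignored throughout.
  A slab is a sheared box inside the cap that is cut off by this plane lowered by \<open>h\<close>.\<close>

definition tilt :: "'d::finite \<Rightarrow> real \<Rightarrow> ('d \<Rightarrow> real) \<Rightarrow> real^'d \<Rightarrow> real" where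
  "tilt z r x y = y $ z + (\<Sum>j\<in>-{z}. x j * y $ j) / r - (\<Sum>j\<in>-{z}. (x j)\<^sup>2) / (2 * r)"

definition slab :: "'d::finite \<Rightarrow> real \<Rightarrow> real \<Rightarrow> real \<Rightarrow> ('d \<Rightarrow> real) \<Rightarrow> (real^'d) set" where
  "slab z r a h x = {y. (\<forall>j. j \<noteq> z \<longrightarrow> - a \<le> y $ j - x j \<and> y $ j - x j < a) \<and>
     - h \<le> tilt z r x y \<and> tilt z r x y < - h / 2}"

text \<open>Completing the square. The height of \<open>y\<close> above the paraboloid is
  independent of \<open>x\<close>, so tilts at different \<open>x\<close> differ only through
  horizontal distances.\<close>

lemma tilt_eq_parabola:
  assumes "r \<noteq> 0"
  shows "tilt z r x y = y $ z + (\<Sum>j\<in>-{z}. (y $ j)\<^sup>2) / (2 * r) - (\<Sum>j\<in>-{z}. (y $ j - x j)\<^sup>2) / (2 * r)"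
proof -
  have "(\<Sum>j\<in>-{z}. (y $ j - x j)\<^sup>2) = (\<Sum>j\<in>-{z}. (y $ j)\<^sup>2) - 2 * (\<Sum>j\<in>-{z}. x j * y $ j) + (\<Sum>j\<in>-{z}. (x j)\<^sup>2)"
    by (simp add: power2_diff sum.distrib sum_subtractf sum_distrib_left mult_ac)
  then show ?thesis using assms by (simp add: tilt_def add_divide_distrib diff_divide_distrib)
qed

text \<open>Replacing \<open>x\<close> by \<open>x'\<close> adds the near term, at most
  \<open>h / 2\<close>, and subtracts the far term, at least \<open>2 * h\<close>. A tilt below
  \<open>- h / 2\<close> thus falls below \<open>- 2 * h\<close>. This is what makes the cap at
  \<open>x'\<close> miss the slab at \<open>x\<close>.\<close>

lemma slab_below_other_tilt:
  fixes y :: "real^'d"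
  assumes r: "r > 0" and a: "a > 0" and h: "h = real CARD('d) * a\<^sup>2 / r"
    and y: "y \<in> slab z r a h x" and j: "j \<noteq> z" "\<bar>x j - x' j\<bar> \<ge> 3 * real CARD('d) * a"
  shows "tilt z r x' y < - h"
proof -
  let ?D = "real CARD('d)"
  have D: "?D \<ge> 1" by (simp add: Suc_leI)
  have close: "\<bar>y $ k - x k\<bar> \<le> a" if "k \<noteq> z" for k
    using y that unfolding slab_def by (auto simp: abs_le_iff)
  have "(\<Sum>k\<in>-{z}. (y $ k - x k)\<^sup>2) \<le> (\<Sum>k\<in>-{z}. a\<^sup>2)"
    using close a by (intro sum_mono) (simp add: abs_le_square_iff[symmetric])
  also have "\<dots> \<le> (\<Sum>k\<in>(UNIV::'d set). a\<^sup>2)" by (intro sum_mono2) auto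
  finally have near: "(\<Sum>k\<in>-{z}. (y $ k - x k)\<^sup>2) / (2 * r) \<le> h / 2"
    unfolding h using r by (simp add: field_simps)
  have "\<bar>y $ j - x' j\<bar> \<ge> 3 * ?D * a - a" using close[OF j(1)] j(2) by linarith
  moreover have "?D * a \<ge> a" using mult_right_mono[OF D, of a] a by simp
  ultimately have "\<bar>2 * (?D * a)\<bar> \<le> \<bar>y $ j - x' j\<bar>" using a by linarith
  then have "(2 * (?D * a))\<^sup>2 \<le> (y $ j - x' j)\<^sup>2" by (simp only: abs_le_square_iff)
  also have "\<dots> \<le> (\<Sum>k\<in>-{z}. (y $ k - x' k)\<^sup>2)"
    by (rule member_le_sum[where f="\<lambda>k. (y $ k - x' k)\<^sup>2"]) (use j in auto)
  finally have "(\<Sum>k\<in>-{z}. (y $ k - x' k)\<^sup>2) / (2 * r) \<ge> (2 * (?D * a))\<^sup>2 / (2 * r)"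
    using r by (intro divide_right_mono) auto
  moreover have "(2 * (?D * a))\<^sup>2 / (2 * r) = 2 * ?D * h"
    unfolding h by (simp add: power2_eq_square)
  moreover have "2 * ?D * h \<ge> 2 * h" using D r unfolding h by (intro mult_right_mono) auto
  moreover have "tilt z r x y < - h / 2" using y by (simp add: slab_def)
  moreover have "h > 0" unfolding h using r a D by simp
  ultimately show ?thesis
    using near r tilt_eq_parabola[of r z x y] tilt_eq_parabola[of r z x' y] by linarith
qed

text \<open>\<open>tilt\<close> is affine in its point argument, so the condition on
  \<open>Y\<close> defines an open half-space that contains the hull and misses
  \<open>q\<close>.\<close>

lemma not_in_hull_other_slabs:
  fixes Y :: "(real^'d) set"
  assumes "tilt z r x q \<ge> - h" and "\<And>y. y \<in> Y \<Longrightarrow> tilt z r x y < - h"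
  shows "q \<notin> convex hull Y"
proof -
  define u where "u = (\<chi> j. if j = z then 1 else x j / r)"
  define c where "c = (\<Sum>j\<in>-{z}. (x j)\<^sup>2) / (2 * r)"
  have u: "tilt z r x y = u \<bullet> y - c" for y
  proof -
    have "u \<bullet> y = u $ z * y $ z + (\<Sum>j\<in>-{z}. u $ j * y $ j)"
      by (simp add: inner_vec_def sum.remove[of UNIV z] Compl_eq_Diff_UNIV)
    also have "\<dots> = y $ z + (\<Sum>j\<in>-{z}. x j / r * y $ j)"
      by (auto simp: u_def intro!: sum.cong)
    also have "(\<Sum>j\<in>-{z}. x j / r * y $ j) = (\<Sum>j\<in>-{z}. x j * y $ j) / r"
      by (simp add: sum_divide_distrib)
    finally show ?thesis by (simp add: tilt_def c_def)
  qed
  have "convex hull Y \<subseteq> {y. u \<bullet> y < c - h}"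
    by (rule hull_minimal) (use assms(2) in \<open>auto simp: u convex_halfspace_lt\<close>, fastforce)
  then show ?thesis using assms(1) u by auto
qed

text \<open>For fixed \<open>x\<close>, the translates of the slab by the lattice of these shifts tile the space, so every
  point lies in exactly one of them.\<close>

definition shift :: "'d::finite \<Rightarrow> real \<Rightarrow> real \<Rightarrow> ('d \<Rightarrow> int) \<Rightarrow> real^'d" where
  "shift z a h k = (\<chi> j. if j = z then h / 2 * of_int (k z) else 2 * a * of_int (k j))"

text \<open>The tilt depends on the horizontal coordinates, so the vertical index is read off only
  after the horizontal shift has been made; the provisional index \<open>0\<close> at
  \<open>z\<close> means no vertical shift yet.\<close>

definition tile :: "'d::finite \<Rightarrow> real \<Rightarrow> real \<Rightarrow> real \<Rightarrow> ('d \<Rightarrow> real) \<Rightarrow> real^'d \<Rightarrow> 'd \<Rightarrow> int" where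
  "tile z r a h x p =
    (let k = (\<lambda>j. if j = z then 0 else \<lfloor>(p $ j - x j + a) / (2 * a)\<rfloor>)
     in k(z := \<lfloor>(tilt z r x (p - shift z a h k) + h) / (h / 2)\<rfloor>))"

lemma floor_divide_bounds:
  fixes u v :: real
  assumes "v > 0"
  shows "0 \<le> u - v * of_int \<lfloor>u / v\<rfloor>" "u - v * of_int \<lfloor>u / v\<rfloor> < v"
proof -
  have "of_int \<lfloor>u / v\<rfloor> \<le> u / v" "u / v < of_int \<lfloor>u / v\<rfloor> + 1" by linarith+
  then show "0 \<le> u - v * of_int \<lfloor>u / v\<rfloor>" "u - v * of_int \<lfloor>u / v\<rfloor> < v"
    using assms by (simp_all only: pos_le_divide_eq pos_divide_less_eq) (simp_all add: algebra_simps)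
qed

text \<open>A vertical shift leaves the horizontal coordinates alone and changes the tilt by exactly
  its length. The lattice steps \<open>2 * a\<close> and \<open>h / 2\<close> are the width and the
  thickness of the slab.\<close>

lemma mem_slab_tile:
  fixes p :: "real^'d"
  assumes a: "a > 0" and h: "h > 0"
  shows "p - shift z a h (tile z r a h x p) \<in> slab z r a h x"
proof -
  define k where "k = (\<lambda>j. if j = z then 0 else \<lfloor>(p $ j - x j + a) / (2 * a)\<rfloor>)"
  define m where "m = \<lfloor>(tilt z r x (p - shift z a h k) + h) / (h / 2)\<rfloor>"
  have tile: "tile z r a h x p = k(z := m)" by (simp add: tile_def k_def m_def Let_def)
  let ?y = "p - shift z a h (k(z := m))"
  have "- a \<le> ?y $ j - x j \<and> ?y $ j - x j < a" if "j \<noteq> z" for j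
    using floor_divide_bounds[of "2 * a" "p $ j - x j + a"] a that by (simp add: shift_def k_def)
  moreover have "tilt z r x ?y = tilt z r x (p - shift z a h k) - h / 2 * of_int m"
    by (simp add: tilt_def shift_def k_def)
  moreover have "0 \<le> tilt z r x (p - shift z a h k) + h - h / 2 * of_int m"
    "tilt z r x (p - shift z a h k) + h - h / 2 * of_int m < h / 2"
    using floor_divide_bounds[of "h / 2" "tilt z r x (p - shift z a h k) + h"] h unfolding m_def by auto
  ultimately show ?thesis unfolding tile slab_def by (simp add: diff_diff_eq)
qed

lemma tilt_diff:
  "tilt z r x y - tilt z r x y' = (y - y') $ z + (\<Sum>j\<in>-{z}. (y - y') $ j * (x j / r))"
  by (simp add: tilt_def sum_divide_distrib diff_divide_distrib sum_subtractf algebra_simps)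

text \<open>The second bound says that the normal of the slab is nearly orthogonal to the
  difference. It is affine in \<open>x\<close>, so for a given difference it confines
  \<open>x\<close> to a strip.\<close>

lemma same_slab_diff:
  fixes y y' :: "real^'d"
  assumes "y \<in> slab z r a h x" "y' \<in> slab z r a h x"
  shows "j \<noteq> z \<Longrightarrow> \<bar>(y - y') $ j\<bar> \<le> 2 * a"
    and "\<bar>(y - y') $ z + (\<Sum>j\<in>-{z}. (y - y') $ j * (x j / r))\<bar> \<le> h / 2"
proof -
  show "\<bar>(y - y') $ j\<bar> \<le> 2 * a" if "j \<noteq> z"
  proof -
    have "- a \<le> y $ j - x j" "y $ j - x j < a" "- a \<le> y' $ j - x j" "y' $ j - x j < a"
      using assms that by (auto simp: slab_def)
    then show ?thesis by simp
  qed
  show "\<bar>(y - y') $ z + (\<Sum>j\<in>-{z}. (y - y') $ j * (x j / r))\<bar> \<le> h / 2"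
  proof -
    have "- h \<le> tilt z r x y" "tilt z r x y < - h / 2" "- h \<le> tilt z r x y'" "tilt z r x y' < - h / 2"
      using assms by (auto simp: slab_def)
    then show ?thesis unfolding tilt_diff[symmetric] by linarith
  qed
qed

text \<open>Both \<open>p\<close> and the slab lie within a constant multiple of \<open>r\<close> of
  the origin, hence so does the shift between them; dividing by the lattice steps bounds the
  indices. Only finitely many translations therefore enter the average.\<close>

lemma abs_tile_le:
  fixes p :: "real^'d"
  assumes r: "r > 0" and a: "0 < a" "a \<le> r" and h: "0 < h" "h \<le> r"
    and x: "\<And>j. j \<noteq> z \<Longrightarrow> 0 \<le> x j \<and> x j \<le> r"
    and p: "norm p \<le> \<alpha> * r" and \<alpha>: "\<alpha> \<ge> 0"
  defines "B \<equiv> \<alpha> + 3 * real CARD('d) + 2"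
  shows "j \<noteq> z \<Longrightarrow> \<bar>of_int (tile z r a h x p j)\<bar> \<le> B * r / a"
    and "\<bar>of_int (tile z r a h x p z)\<bar> \<le> 2 * B * r / h"
proof -
  let ?D = "real CARD('d)"
  define k where "k = tile z r a h x p"
  define y where "y = p - shift z a h k"
  have y: "y \<in> slab z r a h x" unfolding y_def k_def by (rule mem_slab_tile) (use a h in auto)
  have pj: "\<bar>p $ j\<bar> \<le> \<alpha> * r" for j using component_le_norm_cart[of p j] p by linarith
  have D: "?D \<ge> 1" by (simp add: Suc_leI)
  have Dr: "?D * r \<ge> r" using D r mult_right_mono[of 1 ?D r] by simp
  have yj: "\<bar>y $ j\<bar> \<le> 2 * r" if "j \<noteq> z" for j
  proof -
    have "- a \<le> y $ j - x j" "y $ j - x j < a" using y that by (auto simp: slab_def)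
    then show ?thesis using x[OF that] a by linarith
  qed
  show "\<bar>of_int (tile z r a h x p j)\<bar> \<le> B * r / a" if "j \<noteq> z"
  proof -
    have "p $ j - y $ j = 2 * a * of_int (k j)" using that by (simp add: y_def shift_def)
    then have "\<bar>2 * a * of_int (k j)\<bar> \<le> \<alpha> * r + 2 * r" using pj[of j] yj[OF that] by linarith
    then have "2 * a * \<bar>of_int (k j)\<bar> \<le> \<alpha> * r + 2 * r" using a by (simp add: abs_mult)
    moreover have "B * r = \<alpha> * r + 3 * (?D * r) + 2 * r" by (simp add: B_def algebra_simps)
    ultimately have "2 * (a * \<bar>of_int (k j)\<bar>) \<le> B * r" using Dr r by linarith
    moreover have "a * \<bar>of_int (k j)\<bar> \<ge> 0" using a by simp
    ultimately have "a * \<bar>of_int (k j)\<bar> \<le> B * r" by linarith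
    then show ?thesis using a unfolding k_def by (simp add: pos_le_divide_eq mult.commute)
  qed
  have s1: "\<bar>\<Sum>j\<in>-{z}. x j * y $ j\<bar> \<le> ?D * (2 * r * r)"
  proof -
    have "\<bar>\<Sum>j\<in>-{z}. x j * y $ j\<bar> \<le> (\<Sum>j\<in>-{z}. r * (2 * r))"
      by (rule order_trans[OF sum_abs], rule sum_mono)
         (use x yj r in \<open>auto simp: abs_mult intro!: mult_mono\<close>)
    also have "\<dots> \<le> (\<Sum>j\<in>(UNIV::'d set). r * (2 * r))" using r by (intro sum_mono2) auto
    finally show ?thesis by (simp add: mult_ac)
  qed
  have s2: "(\<Sum>j\<in>-{z}. (x j)\<^sup>2) \<le> ?D * r\<^sup>2"
  proof -
    have "(\<Sum>j\<in>-{z}. (x j)\<^sup>2) \<le> (\<Sum>j\<in>-{z}. r\<^sup>2)" by (intro sum_mono power_mono) (use x in auto)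
    also have "\<dots> \<le> (\<Sum>j\<in>(UNIV::'d set). r\<^sup>2)" by (intro sum_mono2) auto
    finally show ?thesis by simp
  qed
  \<comment> \<open>Solved for the height, the definition of \<open>tilt\<close> leaves three terms,
    of size at most \<open>h\<close>, \<open>2 * D * r\<close> and \<open>D * r\<close>, where
    \<open>D\<close> is the dimension.\<close>
  have t: "y $ z = tilt z r x y - (\<Sum>j\<in>-{z}. x j * y $ j) / r + (\<Sum>j\<in>-{z}. (x j)\<^sup>2) / (2 * r)"
    by (simp add: tilt_def)
  have "\<bar>(\<Sum>j\<in>-{z}. x j * y $ j) / r\<bar> \<le> 2 * (?D * r)"
    using divide_right_mono[OF s1, of r] r by (simp add: abs_divide)
  moreover have "(\<Sum>j\<in>-{z}. (x j)\<^sup>2) / (2 * r) \<le> ?D * r"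
  proof -
    have "(\<Sum>j\<in>-{z}. (x j)\<^sup>2) / (2 * r) \<le> ?D * r\<^sup>2 / (2 * r)"
      using s2 r by (intro divide_right_mono) auto
    also have "\<dots> = ?D * r / 2" using r by (simp add: power2_eq_square)
    finally show ?thesis using Dr r by linarith
  qed
  moreover have "(\<Sum>j\<in>-{z}. (x j)\<^sup>2) / (2 * r) \<ge> 0" using r by (simp add: sum_nonneg)
  moreover have "\<bar>tilt z r x y\<bar> \<le> h" using y h by (auto simp: slab_def)
  ultimately have yz: "\<bar>y $ z\<bar> \<le> 3 * (?D * r) + r" using t h by linarith
  have "p $ z - y $ z = h / 2 * of_int (k z)" by (simp add: y_def shift_def)
  then have "\<bar>h / 2 * of_int (k z)\<bar> \<le> \<alpha> * r + 3 * (?D * r) + r" using pj[of z] yz by linarith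
  also have "\<dots> \<le> B * r" using r by (simp add: B_def algebra_simps)
  finally have "h * \<bar>of_int (k z)\<bar> \<le> 2 * B * r" using h by (simp add: abs_mult)
  then show "\<bar>of_int (tile z r a h x p z)\<bar> \<le> 2 * B * r / h"
    using h unfolding k_def by (simp add: pos_le_divide_eq mult.commute)
qed

subsection \<open>Pairs of points in a common slab\<close>

lemma card_nats_in_strip_le:
  fixes b c e :: real
  assumes b: "b \<noteq> 0" and e: "e \<ge> 0"
  shows "real (card {k. k < K \<and> \<bar>c + b * real k\<bar> \<le> e}) \<le> 2 * e / \<bar>b\<bar> + 1"
proof (cases "{k. k < K \<and> \<bar>c + b * real k\<bar> \<le> e} = {}")
  case True
  then show ?thesis using e by (simp only: card.empty) simp
next
  case False
  let ?S = "{k. k < K \<and> \<bar>c + b * real k\<bar> \<le> e}"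
  define m where "m = Min ?S"
  define w where "w = nat \<lfloor>2 * e / \<bar>b\<bar>\<rfloor>"
  have fin: "finite ?S" by simp
  have m: "m \<in> ?S" unfolding m_def using False fin by (intro Min_in) auto
  have "?S \<subseteq> {m..m + w}"
  proof
    fix k assume k: "k \<in> ?S"
    then have "m \<le> k" unfolding m_def using fin by (intro Min_le) auto
    have "\<bar>(c + b * real k) - (c + b * real m)\<bar> \<le> 2 * e" using k m by auto
    moreover have "(c + b * real k) - (c + b * real m) = b * (real k - real m)" by (simp add: algebra_simps)
    ultimately have "\<bar>b\<bar> * (real k - real m) \<le> 2 * e" using \<open>m \<le> k\<close> by (simp add: abs_mult)
    then have "real k - real m \<le> 2 * e / \<bar>b\<bar>" using b by (simp add: pos_le_divide_eq mult.commute)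
    then have "k \<le> m + w" unfolding w_def by linarith
    then show "k \<in> {m..m + w}" using \<open>m \<le> k\<close> by simp
  qed
  then have "card ?S \<le> card {m..m + w}" by (intro card_mono) auto
  then have "real (card ?S) \<le> real w + 1" by simp
  moreover have "real w \<le> 2 * e / \<bar>b\<bar>" unfolding w_def using e by (simp add: of_nat_nat)
  ultimately show ?thesis by linarith
qed

text \<open>The grid splits into \<open>K ^ (card J - 1)\<close> rows in direction \<open>j\<close>,
  and along each row the affine form has slope \<open>b j\<close>.\<close>

lemma card_grid_in_strip_le:
  fixes b :: "'j \<Rightarrow> real"
  assumes J: "finite J" "j \<in> J" and b: "b j \<noteq> 0" and e: "e \<ge> 0"
  shows "real (card {i \<in> PiE J (\<lambda>_. {..<K}). \<bar>c + (\<Sum>l\<in>J. b l * real (i l))\<bar> \<le> e})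
    \<le> real K ^ (card J - 1) * (2 * e / \<bar>b j\<bar> + 1)"
proof -
  let ?S = "{i \<in> PiE J (\<lambda>_. {..<K}). \<bar>c + (\<Sum>l\<in>J. b l * real (i l))\<bar> \<le> e}"
  define A where "A = PiE (J - {j}) (\<lambda>_. {..<K})"
  define G where "G f = {k. k < K \<and> \<bar>(c + (\<Sum>l\<in>J-{j}. b l * real (f l))) + b j * real k\<bar> \<le> e}" for f
  have fA: "finite A" unfolding A_def using J by (intro finite_PiE) auto
  have fG: "finite (G f)" for f by (simp add: G_def)
  have "?S \<subseteq> (\<lambda>(f, k). f(j := k)) ` Sigma A G"
  proof
    fix i assume i: "i \<in> ?S"
    \<comment> \<open>Resetting coordinate \<open>j\<close> to \<open>undefined\<close> makes
      \<open>f\<close> extensional on \<open>J - {j}\<close>, as membership in \<open>A\<close>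
      demands.\<close>
    define f where "f = i(j := undefined)"
    have "f \<in> A" using i by (auto simp: f_def A_def PiE_def Pi_def extensional_def)
    moreover have "i j \<in> G f"
    proof -
      have "(\<Sum>l\<in>J. b l * real (i l)) = b j * real (i j) + (\<Sum>l\<in>J-{j}. b l * real (f l))"
        using J by (simp add: sum.remove f_def)
      then show ?thesis using i J by (auto simp: G_def PiE_def Pi_def add_ac)
    qed
    moreover have "i = f(j := i j)" by (simp add: f_def)
    ultimately show "i \<in> (\<lambda>(f, k). f(j := k)) ` Sigma A G"
      by (intro image_eqI[where x="(f, i j)"]) auto
  qed
  then have "card ?S \<le> card (Sigma A G)" using fA fG by (intro surj_card_le) auto
  also have "\<dots> = (\<Sum>f\<in>A. card (G f))" using fA fG by simp
  finally have "real (card ?S) \<le> real (\<Sum>f\<in>A. card (G f))" by (rule of_nat_mono)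
  also have "\<dots> = (\<Sum>f\<in>A. real (card (G f)))" by (rule of_nat_sum)
  also have "\<dots> \<le> (\<Sum>f\<in>A. 2 * e / \<bar>b j\<bar> + 1)"
    unfolding G_def by (intro sum_mono card_nats_in_strip_le b e)
  also have "\<dots> = real (card A) * (2 * e / \<bar>b j\<bar> + 1)" by simp
  also have "card A = K ^ (card J - 1)" unfolding A_def using J by (simp add: card_PiE)
  finally show ?thesis by simp
qed

text \<open>The spacing is the separation that \<open>slab_below_other_tilt\<close> asks
  for.\<close>

definition grid_point :: "real \<Rightarrow> ('d::finite \<Rightarrow> nat) \<Rightarrow> 'd \<Rightarrow> real" where
  "grid_point a i j = 3 * real CARD('d) * a * real (i j)"

lemma grid_point_bounds:
  fixes j :: "'d::finite"
  assumes "a > 0" "3 * real CARD('d) * a * real K \<le> r" "i j < K"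
  shows "0 \<le> grid_point a i j" "grid_point a i j \<le> r"
proof -
  have "3 * real CARD('d) * a * real (i j) \<le> 3 * real CARD('d) * a * real K"
    using assms by (intro mult_left_mono) auto
  then show "0 \<le> grid_point a i j" "grid_point a i j \<le> r"
    using assms unfolding grid_point_def by (simp, linarith)
qed

text \<open>A collision puts translates of \<open>p\<close> and \<open>q\<close> by one vector into
  one slab. Then the largest horizontal coordinate of \<open>p - q\<close> is comparable to the
  distance, which forces the distance to be of order \<open>a\<close> and makes the strip condition
  steep along the grid rows in that coordinate direction.\<close>

lemma card_collisions_le:
  fixes p q :: "real^'d"
  assumes d: "CARD('d) \<ge> 2" and r: "r > 0" and a: "a > 0"
    and h: "h = real CARD('d) * a\<^sup>2 / r" "h \<le> 1"
    and K: "3 * real CARD('d) * a * real K \<le> r"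
    and sep: "dist p q \<ge> 1"
  shows "real (card {i \<in> PiE (-{z}) (\<lambda>_. {..<K}).
      tile z r a h (grid_point a i) p = tile z r a h (grid_point a i) q})
    \<le> (if dist p q \<le> 8 * real CARD('d) * a
        then real K ^ (CARD('d) - 2) * (12 * real CARD('d) * a) * (1 / dist p q) else 0)"
    (is "real (card ?S) \<le> ?rhs")
proof (cases "?S = {}")
  case True
  have "?rhs \<ge> 0" using a by simp
  then show ?thesis unfolding True by simp
next
  case False
  let ?D = "real CARD('d)"
  let ?I = "PiE (-{z}) (\<lambda>_. {..<K})"
  define v where "v = p - q"
  have D: "?D \<ge> 2" using d by simp
  have h0: "h > 0" using h(1) D a r by simp
  have same: "(\<forall>j. j \<noteq> z \<longrightarrow> \<bar>v $ j\<bar> \<le> 2 * a)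
      \<and> \<bar>v $ z + (\<Sum>j\<in>-{z}. v $ j * (grid_point a i j / r))\<bar> \<le> h / 2" if "i \<in> ?S" for i
  proof -
    define \<tau> where "\<tau> = shift z a h (tile z r a h (grid_point a i) p)"
    have "p - \<tau> \<in> slab z r a h (grid_point a i)" unfolding \<tau>_def using mem_slab_tile a h0 by blast
    moreover have "q - \<tau> \<in> slab z r a h (grid_point a i)"
      unfolding \<tau>_def using mem_slab_tile[OF a h0, of q z r "grid_point a i"] that by simp
    moreover have "(p - \<tau>) - (q - \<tau>) = v" by (simp add: v_def)
    ultimately show ?thesis using same_slab_diff[of "p - \<tau>" z r a h "grid_point a i" "q - \<tau>"] by simp
  qed
  obtain i0 where i0: "i0 \<in> ?S" using False by blast
  have ne: "-{z} \<noteq> {}"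
  proof
    assume "-{z} = {}"
    then have "UNIV = {z}" by auto
    then have "CARD('d) = 1" by (metis card_1_singleton_iff One_nat_def)
    then show False using d by simp
  qed
  define m where "m = Max ((\<lambda>j. \<bar>v $ j\<bar>) ` (-{z}))"
  have "m \<in> (\<lambda>j. \<bar>v $ j\<bar>) ` (-{z})" unfolding m_def using ne by (intro Max_in) auto
  then obtain j0 where j0: "j0 \<noteq> z" "m = \<bar>v $ j0\<bar>" by auto
  have mle: "\<bar>v $ j\<bar> \<le> m" if "j \<noteq> z" for j unfolding m_def using that by (intro Max_ge) auto
  have m0: "m \<ge> 0" using j0 by simp
  have m2a: "m \<le> 2 * a" using same[OF i0] j0 by simp
  have sumle: "(\<Sum>j\<in>-{z}. m) \<le> ?D * m"
  proof -
    have "(\<Sum>j\<in>-{z}. m) \<le> (\<Sum>j\<in>(UNIV::'d set). m)" using m0 by (intro sum_mono2) auto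
    then show ?thesis by simp
  qed
  have g01: "\<bar>grid_point a i0 j / r\<bar> \<le> 1" if "j \<noteq> z" for j
  proof -
    have "i0 j < K" using i0 that by (auto simp: PiE_def Pi_def)
    then show ?thesis using grid_point_bounds[OF a K, of i0 j] r by simp
  qed
  have "\<bar>\<Sum>j\<in>-{z}. v $ j * (grid_point a i0 j / r)\<bar> \<le> (\<Sum>j\<in>-{z}. m)"
  proof (rule order_trans[OF sum_abs], rule sum_mono)
    fix j assume "j \<in> -{z}"
    then show "\<bar>v $ j * (grid_point a i0 j / r)\<bar> \<le> m"
      using mult_mono[OF mle[of j] g01[of j]] m0 by (simp only: abs_mult) auto
  qed
  then have vz: "\<bar>v $ z\<bar> \<le> h / 2 + ?D * m" using same[OF i0] sumle by linarith
  have "norm v \<le> (\<Sum>j\<in>UNIV. \<bar>v $ j\<bar>)" by (rule norm_le_l1_cart)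
  also have "\<dots> = \<bar>v $ z\<bar> + (\<Sum>j\<in>-{z}. \<bar>v $ j\<bar>)"
    by (simp add: sum.remove[of UNIV z] Compl_eq_Diff_UNIV)
  also have "(\<Sum>j\<in>-{z}. \<bar>v $ j\<bar>) \<le> (\<Sum>j\<in>-{z}. m)" using mle by (intro sum_mono) auto
  finally have "norm v \<le> h / 2 + 2 * (?D * m)" using vz sumle by linarith
  moreover have nv: "norm v = dist p q" by (simp add: v_def dist_norm)
  \<comment> \<open>As \<open>h \<le> 1 \<le> dist p q\<close>, the term \<open>h / 2\<close> is
    absorbed by half of the distance.\<close>
  ultimately have n4: "dist p q \<le> 4 * (?D * m)" using sep h(2) by linarith
  have mpos: "m > 0" using n4 sep D m0 by (cases "m = 0") auto
  have "?D * m \<le> ?D * (2 * a)" using m2a by (intro mult_left_mono) auto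
  then have close: "dist p q \<le> 8 * ?D * a" using n4 by linarith
  \<comment> \<open>Coefficients of the strip condition as an affine form in the integer grid
    indices.\<close>
  define b where "b j = v $ j * (3 * ?D * a / r)" for j
  have "?S \<subseteq> {i \<in> ?I. \<bar>v $ z + (\<Sum>l\<in>-{z}. b l * real (i l))\<bar> \<le> h / 2}"
  proof
    fix i assume i: "i \<in> ?S"
    have "(\<Sum>l\<in>-{z}. b l * real (i l)) = (\<Sum>l\<in>-{z}. v $ l * (grid_point a i l / r))"
      by (simp add: b_def grid_point_def mult.assoc)
    then show "i \<in> {i \<in> ?I. \<bar>v $ z + (\<Sum>l\<in>-{z}. b l * real (i l))\<bar> \<le> h / 2}"
      using i same[OF i] by simp
  qed
  then have "card ?S \<le> card {i \<in> ?I. \<bar>v $ z + (\<Sum>l\<in>-{z}. b l * real (i l))\<bar> \<le> h / 2}"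
  proof (rule card_mono[rotated])
    have "finite ?I" by (intro finite_PiE) auto
    then show "finite {i \<in> ?I. \<bar>v $ z + (\<Sum>l\<in>-{z}. b l * real (i l))\<bar> \<le> h / 2}" by simp
  qed
  also have "real \<dots> \<le> real K ^ (card (-{z}) - 1) * (2 * (h / 2) / \<bar>b j0\<bar> + 1)"
  proof (rule card_grid_in_strip_le)
    show "b j0 \<noteq> 0" using j0 mpos D a r by (auto simp: b_def)
  qed (use j0 h0 in auto)
  also have "card (-{z}) - 1 = CARD('d) - 2" by (simp add: Compl_eq_Diff_UNIV)
  also have "2 * (h / 2) / \<bar>b j0\<bar> = a / (3 * m)"
  proof -
    have "\<bar>b j0\<bar> = m * (3 * ?D * a / r)" using j0 D a r by (simp add: b_def abs_mult)
    then show ?thesis unfolding h(1) using D a r mpos by (simp add: field_simps power2_eq_square)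
  qed
  also have "real K ^ (CARD('d) - 2) * (a / (3 * m) + 1) \<le> real K ^ (CARD('d) - 2) * (12 * ?D * a * (1 / dist p q))"
  proof (rule mult_left_mono)
    \<comment> \<open>The summand \<open>1\<close> is at most \<open>2 * a / m\<close> because
      \<open>m \<le> 2 * a\<close>.\<close>
    have "a / (3 * m) + 1 \<le> 3 * a / m" using mpos m2a by (simp add: field_simps)
    also have "3 * a / m \<le> 12 * ?D * a * (1 / dist p q)"
    proof -
      have "3 * a * dist p q \<le> 3 * a * (4 * (?D * m))" using n4 a by (intro mult_left_mono) auto
      moreover have *: "3 * a / m \<le> 12 * ?D * a * (1 / t)" if "t > 0" "3 * a * t \<le> 3 * a * (4 * (?D * m))" for t
        using that mpos by (simp add: field_simps)
      ultimately show ?thesis by (intro *) (use sep in linarith)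
    qed
    finally show "a / (3 * m) + 1 \<le> 12 * ?D * a * (1 / dist p q)" .
  qed simp
  finally show ?thesis using close by (simp add: mult_ac)
qed

lemma card_int_interval_le:
  fixes X :: real
  assumes "X \<ge> 1"
  shows "finite {k::int. \<bar>of_int k\<bar> \<le> X}" "real (card {k::int. \<bar>of_int k\<bar> \<le> X}) \<le> 3 * X"
proof -
  have "{k::int. \<bar>of_int k\<bar> \<le> X} = {-\<lfloor>X\<rfloor>..\<lfloor>X\<rfloor>}" by (auto simp: le_floor_iff) linarith+
  then show "finite {k::int. \<bar>of_int k\<bar> \<le> X}" "real (card {k::int. \<bar>of_int k\<bar> \<le> X}) \<le> 3 * X"
    using assms by (simp_all, linarith)
qed

text \<open>The pair bound supplies one factor \<open>a\<close>, and the sum of inverse distances up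
  to \<open>8 * D * a\<close>, with \<open>D\<close> the dimension, supplies
  \<open>a ^ (d - 1)\<close>.\<close>

lemma sum_card_collisions_le:
  fixes P :: "(real^'d) set"
  assumes d: "CARD('d) \<ge> 2" and r: "r > 0" and a: "a > 0"
    and h: "h = real CARD('d) * a\<^sup>2 / r" "h \<le> 1"
    and K: "3 * real CARD('d) * a * real K \<le> r"
    and fin: "finite P" and sep: "\<And>p q. p \<in> P \<Longrightarrow> q \<in> P \<Longrightarrow> p \<noteq> q \<Longrightarrow> dist p q \<ge> 1"
  shows "(\<Sum>p\<in>P. \<Sum>q\<in>P-{p}. real (card {i \<in> PiE (-{z}) (\<lambda>_. {..<K}).
      tile z r a h (grid_point a i) p = tile z r a h (grid_point a i) q}))
    \<le> real (card P) * (real K ^ (CARD('d) - 2) *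
       (48 * real CARD('d) * (5 * real CARD('d)) ^ CARD('d) * (16 * real CARD('d)) ^ (CARD('d) - 1) * a ^ CARD('d)))"
proof -
  let ?D = "real CARD('d)"
  define M where "M = real K ^ (CARD('d) - 2) * (12 * ?D * a)"
  have M: "M \<ge> 0" unfolding M_def using a by simp
  have "(\<Sum>q\<in>P-{p}. real (card {i \<in> PiE (-{z}) (\<lambda>_. {..<K}).
      tile z r a h (grid_point a i) p = tile z r a h (grid_point a i) q}))
    \<le> M * (4 * (5 * ?D) ^ CARD('d) * (2 * (8 * ?D * a)) ^ (CARD('d) - 1))" if p: "p \<in> P" for p
  proof -
    have "(\<Sum>q\<in>P-{p}. real (card {i \<in> PiE (-{z}) (\<lambda>_. {..<K}).
      tile z r a h (grid_point a i) p = tile z r a h (grid_point a i) q}))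
      \<le> (\<Sum>q\<in>P-{p}. if dist p q \<le> 8 * ?D * a then M * (1 / dist p q) else 0)"
      unfolding M_def by (intro sum_mono card_collisions_le d r a h K) (use sep p in auto)
    also have "\<dots> = M * (\<Sum>q\<in>{q\<in>P-{p}. dist p q \<le> 8 * ?D * a}. 1 / dist p q)"
      using fin by (subst sum.inter_filter[symmetric]) (auto simp: sum_distrib_left)
    also have "\<dots> \<le> M * (4 * (5 * ?D) ^ CARD('d) * (2 * (8 * ?D * a)) ^ (CARD('d) - 1))"
      by (intro mult_left_mono sum_inverse_dist_separated_le M) (use d fin sep p a in auto)
    finally show ?thesis .
  qed
  then have "(\<Sum>p\<in>P. \<Sum>q\<in>P-{p}. real (card {i \<in> PiE (-{z}) (\<lambda>_. {..<K}).
      tile z r a h (grid_point a i) p = tile z r a h (grid_point a i) q}))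
    \<le> (\<Sum>p\<in>P. M * (4 * (5 * ?D) ^ CARD('d) * (2 * (8 * ?D * a)) ^ (CARD('d) - 1)))"
    by (rule sum_mono)
  also have "\<dots> = real (card P) * (real K ^ (CARD('d) - 2) *
       (48 * ?D * (5 * ?D) ^ CARD('d) * (16 * ?D) ^ (CARD('d) - 1) * (a * a ^ (CARD('d) - 1))))"
  proof -
    have "2 * (8 * ?D * a) = 16 * ?D * a" by simp
    then show ?thesis unfolding M_def by (simp only: power_mult_distrib[of "16 * ?D" a]) (simp only: mult_ac mult_numeral_1, simp)
  qed
  also have "a * a ^ (CARD('d) - 1) = a ^ CARD('d)" using d by (cases "CARD('d)") auto
  finally show ?thesis .
qed

subsection \<open>Convex subsets of separated sets\<close>

text \<open>One point is chosen for each index whose tile is \<open>k\<close>. As \<open>k\<close>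
  is common, a single shift \<open>s\<close> carries each chosen point into its own slab, and each
  bounding hyperplane separates its point from all the others. The same separation makes the choice
  injective.\<close>

lemma hull_avoiding_selection:
  fixes P :: "(real^'d) set"
  assumes r: "r > 0" and a: "a > 0" and h: "h = real CARD('d) * a\<^sup>2 / r"
  obtains Q where "Q \<subseteq> P" "\<forall>q\<in>Q. q \<notin> convex hull (Q - {q})"
    "card Q = card {i \<in> PiE (-{z::'d}) (\<lambda>_. {..<K}). \<exists>p\<in>P. tile z r a h (grid_point a i) p = k}"
proof -
  define I where "I = {i \<in> PiE (-{z}) (\<lambda>_. {..<K}). \<exists>p\<in>P. tile z r a h (grid_point a i) p = k}"
  define s where "s = shift z a h k"
  have h0: "h > 0" using h a r by simp
  have "\<forall>i\<in>I. \<exists>p\<in>P. tile z r a h (grid_point a i) p = k" by (simp add: I_def)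
  then obtain f where f: "\<And>i. i \<in> I \<Longrightarrow> f i \<in> P \<and> tile z r a h (grid_point a i) (f i) = k" by metis
  have sl: "f i - s \<in> slab z r a h (grid_point a i)" if "i \<in> I" for i
    using mem_slab_tile[OF a h0, of "f i" z r "grid_point a i"] f[OF that] by (simp add: s_def)
  have below: "tilt z r (grid_point a i') (f i - s) < - h" if i: "i \<in> I" "i' \<in> I" "i \<noteq> i'" for i i'
  proof -
    \<comment> \<open>Elements of the index set agree at \<open>z\<close>, where both are
      \<open>undefined\<close>.\<close>
    have "\<exists>j. j \<noteq> z \<and> i j \<noteq> i' j"
    proof (rule ccontr)
      assume "\<not> ?thesis"
      then have "i = i'" using i by (intro PiE_ext[of i "-{z}" "\<lambda>_. {..<K}" i']) (auto simp: I_def)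
      then show False using i by simp
    qed
    then obtain j where j: "j \<noteq> z" "i j \<noteq> i' j" by blast
    have "\<bar>real (i j) - real (i' j)\<bar> \<ge> 1" using j(2) by linarith
    then have "3 * real CARD('d) * a * 1 \<le> 3 * real CARD('d) * a * \<bar>real (i j) - real (i' j)\<bar>"
      using a by (intro mult_left_mono) auto
    also have "\<dots> = \<bar>grid_point a i j - grid_point a i' j\<bar>"
      using a by (simp add: grid_point_def right_diff_distrib[symmetric] abs_mult)
    finally show ?thesis using slab_below_other_tilt[OF r a h sl[OF i(1)] j(1), of "grid_point a i'"] by simp
  qed
  have inj: "inj_on f I"
  proof (rule inj_onI, rule ccontr)
    fix i i' assume i: "i \<in> I" "i' \<in> I" "f i = f i'" "i \<noteq> i'"
    have "tilt z r (grid_point a i') (f i' - s) \<ge> - h" using sl[OF i(2)] by (simp add: slab_def)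
    then show False using below[OF i(1,2,4)] i(3) by simp
  qed
  have hull: "q \<notin> convex hull (f ` I - {q})" if qf: "q \<in> f ` I" for q
  proof
    assume q: "q \<in> convex hull (f ` I - {q})"
    obtain i where i: "i \<in> I" "q = f i" using qf by blast
    have "q - s \<notin> convex hull ((\<lambda>y. - s + y) ` (f ` I - {q}))"
    proof (rule not_in_hull_other_slabs)
      show "- h \<le> tilt z r (grid_point a i) (q - s)" using sl[OF i(1)] i by (simp add: slab_def)
      fix y assume "y \<in> (\<lambda>y. - s + y) ` (f ` I - {q})"
      then obtain i' where "i' \<in> I" "y = f i' - s" "f i' \<noteq> f i" using i by auto
      then show "tilt z r (grid_point a i) y < - h" using below[of i' i] i by auto
    qed
    moreover have "- s + q \<in> convex hull ((\<lambda>y. - s + y) ` (f ` I - {q}))"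
      unfolding convex_hull_translation using q by (rule imageI)
    ultimately show False by simp
  qed
  show ?thesis
    by (rule that[of "f ` I"]) (use f hull in \<open>auto simp: card_image[OF inj] I_def[symmetric]\<close>)
qed

text \<open>The equation for \<open>a\<close> balances two counts: the number of translations is at
  most a constant times \<open>r ^ d = card P\<close>, while the collisions cost at most half of the
  incidences. Averaging then finds a translation that hits a constant fraction of the slabs.\<close>

lemma large_convex_subset_of_separated_set:
  fixes P :: "(real^'d) set"
  assumes d: "CARD('d) \<ge> 2" and r: "r > 0" and a: "a > 0" and \<alpha>: "\<alpha> \<ge> 0"
    and fin: "finite P" and ne: "P \<noteq> {}"
    and sep: "\<And>p q. p \<in> P \<Longrightarrow> q \<in> P \<Longrightarrow> p \<noteq> q \<Longrightarrow> dist p q \<ge> 1"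
    and bounded: "\<And>p. p \<in> P \<Longrightarrow> norm p \<le> \<alpha> * r"
    and n: "real (card P) = r ^ CARD('d)"
    and a_eq: "a ^ (CARD('d) + 1) = \<epsilon> * r" and \<epsilon>: "\<epsilon> \<le> 1"
      "\<epsilon> * (48 * real CARD('d) * (5 * real CARD('d)) ^ CARD('d) * (16 * real CARD('d)) ^ (CARD('d) - 1))
        \<le> 1 / (12 * real CARD('d))"
    and large: "a \<ge> 3 * real CARD('d)"
  obtains Q where "Q \<subseteq> P" "\<forall>q\<in>Q. q \<notin> convex hull (Q - {q})"
    "real (card Q) \<ge> real CARD('d) * \<epsilon> / (4 * (3 * (\<alpha> + 3 * real CARD('d) + 2)) ^ CARD('d))
       * (r / (6 * real CARD('d) * a)) ^ (CARD('d) - 1)"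
proof -
  let ?D = "real CARD('d)"
  define z where "z = (undefined :: 'd)"
  define h where "h = ?D * a\<^sup>2 / r"
  define K where "K = nat \<lfloor>r / (3 * ?D * a)\<rfloor>"
  define B where "B = \<alpha> + 3 * ?D + 2"
  define I where "I = PiE (-{z}) (\<lambda>_. {..<K})"
  obtain e where e: "CARD('d) = Suc (Suc e)" using d by (metis Suc_le_D numeral_2_eq_2 Suc_le_mono)
  have D: "?D \<ge> 2" using d by simp
  have a1: "a \<ge> 1" using large D by linarith
  have eps0: "\<epsilon> > 0"
  proof -
    have "\<epsilon> * r > 0" using a a_eq by (metis zero_less_power)
    then show ?thesis using r by (simp add: zero_less_mult_iff)
  qed
  have B1: "B \<ge> 1" using \<alpha> D by (simp add: B_def)
  have er: "\<epsilon> * r \<le> r" using \<epsilon>(1) r mult_right_mono[of \<epsilon> 1 r] by simp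
  \<comment> \<open>Since \<open>d \<ge> 2\<close> and \<open>a \<ge> 1\<close>, the cube of
    \<open>a\<close> is at most \<open>\<epsilon> * r \<le> r\<close>. All size relations between
    \<open>a\<close>, \<open>h\<close> and \<open>r\<close> below follow from this and
    \<open>large\<close>.\<close>
  have "a * a ^ 2 \<le> a ^ (CARD('d) + 1)" using a1 power_increasing[of 3 "CARD('d) + 1" a] d by (simp add: numeral_3_eq_3 power2_eq_square)
  then have aaa: "a * a\<^sup>2 \<le> r" using a_eq er by linarith
  have aa: "3 * ?D * a \<le> a\<^sup>2" using large a by (simp add: power2_eq_square mult_right_mono)
  have a2: "a\<^sup>2 \<le> a * a\<^sup>2" using a1 mult_right_mono[of 1 a "a\<^sup>2"] by simp
  have Dar: "3 * ?D * a \<le> r" using aa a2 aaa by linarith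
  have "?D * a \<ge> a" using D a mult_right_mono[of 1 ?D a] by simp
  then have ar: "a \<le> r" using Dar a by linarith
  have h1: "h \<le> 1"
  proof -
    have "?D * a\<^sup>2 \<le> a * a\<^sup>2" using large D by (intro mult_right_mono) auto
    then show ?thesis unfolding h_def using aaa r by simp
  qed
  have h0: "h > 0" unfolding h_def using D a r by simp
  have hr: "h \<le> r" using h1 a1 ar by linarith
  have K_le: "3 * ?D * a * real K \<le> r"
  proof -
    have "real K \<le> r / (3 * ?D * a)" unfolding K_def using r a by (simp add: of_nat_nat)
    then show ?thesis using a D by (simp add: pos_le_divide_eq mult.commute)
  qed
  \<comment> \<open>Rounding down loses at most a factor \<open>2\<close>, since the quotient is at
    least \<open>1\<close>.\<close>
  have K_ge: "real K \<ge> r / (6 * ?D * a)"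
  proof -
    have "r / (3 * ?D * a) \<ge> 1" using Dar a D by (simp add: pos_le_divide_eq)
    moreover have "real (nat \<lfloor>y\<rfloor>) \<ge> y / 2" if "y \<ge> 1" for y :: real
    proof -
      have "\<lfloor>y\<rfloor> \<ge> 1" using that by simp
      then show ?thesis by linarith
    qed
    ultimately have "real K \<ge> r / (3 * ?D * a) / 2" unfolding K_def by blast
    then show ?thesis by simp
  qed
  have K0: "K > 0" using K_ge r a D by (cases "K = 0") (auto simp: field_simps)
  have cardI: "card I = K ^ (CARD('d) - 1)"
    unfolding I_def by (simp add: card_PiE Compl_eq_Diff_UNIV)
  have finI: "finite I" unfolding I_def by (intro finite_PiE) auto
  have Ine: "I \<noteq> {}" using cardI K0 by auto
  \<comment> \<open>The box of lattice indices given by \<open>abs_tile_le\<close>.\<close>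
  define T where "T = PiE (UNIV::'d set) (\<lambda>j. {k::int. \<bar>of_int k\<bar> \<le> (if j = z then 2 * B * r / h else B * r / a)})"
  have bz: "2 * B * r / h \<ge> 1"
  proof -
    have "h * 1 \<le> r * B" using hr B1 h0 r by (intro mult_mono) auto
    moreover have "r * B \<ge> 0" using r B1 by simp
    ultimately show ?thesis using h0 by (simp add: pos_le_divide_eq mult_ac)
  qed
  have bj: "B * r / a \<ge> 1"
  proof -
    have "a * 1 \<le> r * B" using ar B1 a r by (intro mult_mono) auto
    then show ?thesis using a by (simp add: pos_le_divide_eq mult_ac)
  qed
  have finT: "finite T" unfolding T_def using card_int_interval_le(1) bz bj by (intro finite_PiE) auto
  have "real (card T) = (\<Prod>j\<in>(UNIV::'d set). real (card {k::int. \<bar>of_int k\<bar> \<le> (if j = z then 2 * B * r / h else B * r / a)}))"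
    unfolding T_def by (simp add: card_PiE)
  also have "\<dots> \<le> (\<Prod>j\<in>(UNIV::'d set). if j = z then 3 * (2 * B * r / h) else 3 * (B * r / a))"
    using card_int_interval_le(2)[OF bz] card_int_interval_le(2)[OF bj] by (intro prod_mono) auto
  also have "\<dots> = 3 * (2 * B * r / h) * (\<Prod>j\<in>UNIV-{z}. 3 * (B * r / a))"
    by (subst prod.remove[of UNIV z]) (auto intro!: prod.cong)
  also have "\<dots> = 3 * (2 * B * r / h) * (3 * (B * r / a)) ^ (CARD('d) - 1)" by simp
  also have "\<dots> = 2 * (3 * B) ^ CARD('d) * r ^ CARD('d) / (?D * \<epsilon>)"
  proof -
    \<comment> \<open>\<open>h\<close> contributes \<open>a ^ 2\<close> and the other directions
      \<open>a ^ (d - 1)\<close>; their product is the prescribed power of \<open>a\<close>, which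
      cancels one factor \<open>r\<close>.\<close>
    have "a\<^sup>2 * a ^ (CARD('d) - 1) = \<epsilon> * r" using a_eq by (simp add: e power2_eq_square mult_ac)
    then have "a\<^sup>2 * a ^ Suc e = \<epsilon> * r" by (simp add: e)
    then have p: "?D * a\<^sup>2 * a ^ Suc e = ?D * \<epsilon> * r" by simp
    have "3 * (2 * B * r / h) * (3 * (B * r / a)) ^ (CARD('d) - 1)
        = 2 * (3 * B) * r * r * ((3 * B) ^ Suc e * r ^ Suc e) / (?D * a\<^sup>2 * a ^ Suc e)"
      using r a D unfolding h_def e by (simp add: power_mult_distrib power_divide)
    also have "\<dots> = 2 * (3 * B) * r * r * ((3 * B) ^ Suc e * r ^ Suc e) / (?D * \<epsilon> * r)" unfolding p ..
    also have "2 * (3 * B) * r * r * ((3 * B) ^ Suc e * r ^ Suc e) = 2 * (3 * B) ^ CARD('d) * r ^ CARD('d) * r"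
      by (simp add: e mult_ac)
    also have "\<dots> / (?D * \<epsilon> * r) = 2 * (3 * B) ^ CARD('d) * r ^ CARD('d) / (?D * \<epsilon>)"
      using r by (intro mult_divide_mult_cancel_right) simp
    finally show ?thesis .
  qed
  finally have cardT: "real (card T) \<le> 2 * (3 * B) ^ CARD('d) * r ^ CARD('d) / (?D * \<epsilon>)" .
  define c where "c = 48 * ?D * (5 * ?D) ^ CARD('d) * (16 * ?D) ^ (CARD('d) - 1)"
  have pairs: "(\<Sum>p\<in>P. \<Sum>q\<in>P-{p}. real (card {i \<in> I. tile z r a h (grid_point a i) p = tile z r a h (grid_point a i) q}))
    \<le> real (card P) * real (card I) / 2"
  proof -
    have "(\<Sum>p\<in>P. \<Sum>q\<in>P-{p}. real (card {i \<in> I. tile z r a h (grid_point a i) p = tile z r a h (grid_point a i) q}))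
      \<le> real (card P) * (real K ^ (CARD('d) - 2) * (c * a ^ CARD('d)))"
      unfolding I_def c_def by (rule sum_card_collisions_le[OF d r a h_def h1 K_le fin sep])
    also have "\<dots> \<le> real (card P) * (real K ^ (CARD('d) - 2) * (real K / 2))"
    proof (intro mult_left_mono)
      \<comment> \<open>The smallness of \<open>\<epsilon>\<close> enters here: the collision bound
        drops below half of \<open>r / (6 * D * a) \<le> K\<close>.\<close>
      have "a ^ CARD('d) = \<epsilon> * r / a" using a_eq a by (simp add: field_simps)
      then have "c * a ^ CARD('d) = (\<epsilon> * c) * (r / a)" by simp
      also have "\<dots> \<le> 1 / (12 * ?D) * (r / a)"
        using \<epsilon>(2) r a unfolding c_def by (intro mult_right_mono) auto
      also have "\<dots> = r / (6 * ?D * a) / 2" by simp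
      also have "\<dots> \<le> real K / 2" using K_ge by (rule divide_right_mono) simp
      finally show "c * a ^ CARD('d) \<le> real K / 2" .
    qed auto
    also have "\<dots> = real (card P) * real (card I) / 2" by (simp add: cardI e)
    finally show ?thesis .
  qed
  have inT: "tile z r a h (grid_point a i) p \<in> T" if "p \<in> P" "i \<in> I" for p i
  proof -
    have x: "0 \<le> grid_point a i j \<and> grid_point a i j \<le> r" if "j \<noteq> z" for j
    proof -
      have "i j < K" using \<open>i \<in> I\<close> that by (auto simp: I_def PiE_def Pi_def)
      then show ?thesis using grid_point_bounds[OF a K_le, of i j] by simp
    qed
    show ?thesis
      using abs_tile_le[OF r a ar h0 hr x bounded[OF that(1)] \<alpha>] by (auto simp: T_def B_def)
  qed
  obtain k where k: "real (card P) * real (card I) / 2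
      \<le> real (card {i \<in> I. \<exists>p\<in>P. tile z r a h (grid_point a i) p = k}) * real (card T)"
    by (rule exists_value_attained_often[OF fin finI finT, of "\<lambda>p i. tile z r a h (grid_point a i) p"])
       (use inT ne Ine pairs in auto)
  obtain Q where Q: "Q \<subseteq> P" "\<forall>q\<in>Q. q \<notin> convex hull (Q - {q})"
    "card Q = card {i \<in> I. \<exists>p\<in>P. tile z r a h (grid_point a i) p = k}"
    unfolding I_def by (rule hull_avoiding_selection[OF r a h_def])
  have "r ^ CARD('d) * real (card I) / 2 \<le> real (card Q) * real (card T)" using k Q(3) n by simp
  also have "\<dots> \<le> real (card Q) * (2 * (3 * B) ^ CARD('d) * r ^ CARD('d) / (?D * \<epsilon>))"
    by (intro mult_left_mono cardT) auto
  finally have "r ^ CARD('d) * (real (card I) / 2) \<le> r ^ CARD('d) * (real (card Q) * (2 * (3 * B) ^ CARD('d) / (?D * \<epsilon>)))"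
    by (simp add: mult_ac)
  then have "real (card I) / 2 \<le> real (card Q) * (2 * (3 * B) ^ CARD('d) / (?D * \<epsilon>))"
    using r by (simp only: mult_le_cancel_left_pos zero_less_power)
  then have "?D * \<epsilon> / (4 * (3 * B) ^ CARD('d)) * real (card I) \<le> real (card Q)"
    using D eps0 B1 by (simp add: field_simps)
  moreover have "(r / (6 * ?D * a)) ^ (CARD('d) - 1) \<le> real (card I)"
    unfolding cardI of_nat_power using K_ge r a by (intro power_mono) auto
  then have "?D * \<epsilon> / (4 * (3 * B) ^ CARD('d)) * (r / (6 * ?D * a)) ^ (CARD('d) - 1)
      \<le> ?D * \<epsilon> / (4 * (3 * B) ^ CARD('d)) * real (card I)"
    using eps0 B1 by (intro mult_left_mono) auto
  ultimately have "real (card Q) \<ge> ?D * \<epsilon> / (4 * (3 * B) ^ CARD('d)) * (r / (6 * ?D * a)) ^ (CARD('d) - 1)"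
    by linarith
  then show ?thesis using that[OF Q(1,2)] unfolding B_def by blast
qed

section \<open>Rescaling, small sets and the choice of constants\<close>

lemma general_position_subset:
  "general_position P \<Longrightarrow> Q \<subseteq> P \<Longrightarrow> general_position Q"
  unfolding general_position_def by (meson order_trans)

lemma convex_independent_singleton:
  "convex_independent {p :: 'a::euclidean_space}"
proof -
  have "general_position {p}"
    unfolding general_position_def
  proof clarify
    fix S :: "'a set" assume "S \<subseteq> {p}" "card S = DIM('a) + 1"
    moreover have "card S \<le> 1" using \<open>S \<subseteq> {p}\<close> card_mono[of "{p}" S] by simp
    moreover have "DIM('a) \<ge> 1" using DIM_positive[where 'a='a] by linarith
    ultimately show False by linarith
  qed
  then show ?thesis by (simp add: convex_independent_def)
qed

lemma normalized_diameter_bounds: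
  fixes P :: "'a::metric_space set"
  assumes fin: "finite P" and card: "card P \<ge> 2" and diam: "normalized_diameter P < R"
  obtains m where "m > 0" "\<And>p q. p \<in> P \<Longrightarrow> q \<in> P \<Longrightarrow> p \<noteq> q \<Longrightarrow> m \<le> dist p q"
    "\<And>p q. p \<in> P \<Longrightarrow> q \<in> P \<Longrightarrow> dist p q \<le> R * m"
proof -
  let ?S = "{dist a b | a b. a \<in> P \<and> b \<in> P \<and> a \<noteq> b}"
  have "?S \<subseteq> (\<lambda>(a, b). dist a b) ` (P \<times> P)" by auto
  then have fS: "finite ?S" by (rule finite_subset) (use fin in auto)
  obtain p q where pq: "p \<in> P" "q \<in> P" "p \<noteq> q"
    using card fin by (metis card_le_Suc0_iff_eq not_less_eq_eq numeral_2_eq_2)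
  then have ne: "?S \<noteq> {}" by blast
  have "Min ?S \<in> ?S" using fS ne by (rule Min_in)
  then have m0: "Min ?S > 0" by auto
  have mle: "Min ?S \<le> dist p q" if "p \<in> P" "q \<in> P" "p \<noteq> q" for p q
    using fS by (rule Min_le) (use that in blast)
  have Mle: "dist p q \<le> Max ?S" if "p \<in> P" "q \<in> P" "p \<noteq> q" for p q
    using fS by (rule Max_ge) (use that in blast)
  have R: "Max ?S < R * Min ?S"
    using diam m0 unfolding normalized_diameter_def by (simp add: pos_divide_less_eq)
  \<comment> \<open>Positivity of the maximum makes \<open>R * Min ?S\<close> positive, which covers
    the case \<open>p = q\<close>.\<close>
  have "Max ?S > 0" using Mle[OF pq] pq(3) by (smt (verit) zero_less_dist_iff)
  then have "dist p q \<le> R * Min ?S" if "p \<in> P" "q \<in> P" for p q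
    using Mle[OF that] R by (cases "p = q") auto
  then show ?thesis using that m0 mle by blast
qed

theorem theorem1:
  fixes \<alpha> :: real
  assumes "CARD('d::finite) \<ge> 2" and "\<alpha> > 0"
  shows "\<exists>\<beta>::real. \<beta> > 0 \<and>
    (\<forall>n::nat. n > 0 \<longrightarrow>
      (\<forall>P :: (real ^ 'd) set.
        finite P \<longrightarrow> card P = n \<longrightarrow> general_position P \<longrightarrow>
        normalized_diameter P < \<alpha> * root (CARD('d)) (real n) \<longrightarrow>
        (\<exists>Q. Q \<subseteq> P \<and> convex_independent Q \<and>
          real (card Q) \<ge> \<beta> * real n powr ((real (CARD('d)) - 1) / (real (CARD('d)) + 1)))))"
proof -
  let ?d = "CARD('d)"
  let ?D = "real ?d"
  \<comment> \<open>\<open>c\<close> is the constant of the collision bound and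
    \<open>\<epsilon>\<close> is chosen so that \<open>\<epsilon> * c = 1 / (12 * D)\<close>. Radii
    from \<open>r0\<close> on give \<open>a \<ge> 3 * D\<close>, and the two arguments of the
    minimum in \<open>\<beta>\<close> serve small and large \<open>n\<close>.\<close>
  define c where "c = 48 * ?D * (5 * ?D) ^ ?d * (16 * ?D) ^ (?d - 1)"
  define \<epsilon> where "\<epsilon> = 1 / (12 * ?D * c)"
  define r0 where "r0 = (3 * ?D) ^ (?d + 1) / \<epsilon>"
  define b where "b = ?D * \<epsilon> / (4 * (3 * (\<alpha> + 3 * ?D + 2)) ^ ?d)"
  define \<beta> where "\<beta> = min (1 / r0 ^ ?d) (b * (1 / (6 * ?D)) ^ (?d - 1))"
  define \<gamma> where "\<gamma> = (?D - 1) / (?D + 1)"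
  have D: "?D \<ge> 2" using assms(1) by simp
  have c1: "c \<ge> 1"
  proof -
    have "1 * 1 * 1 \<le> 48 * ?D * (5 * ?D) ^ ?d * (16 * ?D) ^ (?d - 1)"
      using D by (intro mult_mono one_le_power) auto
    then show ?thesis by (simp add: c_def)
  qed
  have eps0: "\<epsilon> > 0" using D c1 by (simp add: \<epsilon>_def)
  have eps1: "\<epsilon> \<le> 1"
  proof -
    have "1 * 1 \<le> 12 * ?D * c" using D c1 by (intro mult_mono) auto
    then have "inverse (12 * ?D * c) \<le> 1" by (intro inverse_le_1_iff[THEN iffD2]) simp
    then show ?thesis unfolding \<epsilon>_def by (simp only: inverse_eq_divide)
  qed
  have r0: "r0 \<ge> 2"
  proof -
    have "2 \<le> 3 * ?D" using D by simp
    also have "\<dots> \<le> (3 * ?D) ^ (?d + 1)" using D by (intro self_le_power) auto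
    also have "\<dots> \<le> r0" using eps0 eps1 D unfolding r0_def by (simp add: pos_le_divide_eq mult_left_le)
    finally show ?thesis .
  qed
  have b0: "b > 0" using D eps0 assms(2) by (simp add: b_def)
  have beta0: "\<beta> > 0" using D r0 b0 by (simp add: \<beta>_def)
  have main: "\<exists>Q. Q \<subseteq> P \<and> convex_independent Q \<and> real (card Q) \<ge> \<beta> * real n powr \<gamma>"
    if n0: "n > 0" and fin: "finite P" and card: "card P = n" and gp: "general_position P"
      and diam: "normalized_diameter P < \<alpha> * root ?d (real n)" for n and P :: "(real^'d) set"
  \<comment> \<open>For small \<open>n\<close> the bound is at most \<open>1\<close> and a singleton
    suffices. As \<open>r0 \<ge> 2\<close>, this case includes \<open>n = 1\<close>, where the
    normalized diameter is unspecified.\<close>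
  proof (cases "real n < r0 ^ ?d")
    case True
    obtain p where "p \<in> P" using card n0 by fastforce
    moreover have "\<beta> * real n powr \<gamma> \<le> 1"
    proof -
      have "real n powr \<gamma> \<le> real n powr 1" using n0 D by (intro powr_mono) (auto simp: \<gamma>_def)
      then have "\<beta> * real n powr \<gamma> \<le> 1 / r0 ^ ?d * r0 ^ ?d"
        using True n0 beta0 r0 by (intro mult_mono) (auto simp: \<beta>_def)
      then show ?thesis using r0 by simp
    qed
    ultimately show ?thesis
      using convex_independent_singleton[of p] by (intro exI[of _ "{p}"]) simp
  next
    case False
    define r where "r = root ?d (real n)"
    define a where "a = root (?d + 1) (\<epsilon> * r)"
    have rn: "r ^ ?d = real n" unfolding r_def using assms(1) by (simp add: real_root_pow_pos2)
    have r: "r > 0" unfolding r_def using n0 by simp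
    have rr0: "r \<ge> r0"
    proof (rule ccontr)
      assume "\<not> r \<ge> r0"
      then have "r ^ ?d < r0 ^ ?d" using r by (intro power_strict_mono) auto
      then show False using rn False by simp
    qed
    have an: "a ^ (?d + 1) = \<epsilon> * r" unfolding a_def using eps0 r by (intro real_root_pow_pos2) auto
    have a: "a > 0" unfolding a_def using eps0 r by simp
    have large: "a \<ge> 3 * ?D"
    proof (rule ccontr)
      assume "\<not> ?thesis"
      then have "a ^ (?d + 1) < (3 * ?D) ^ (?d + 1)" using a by (intro power_strict_mono) auto
      moreover have "(3 * ?D) ^ (?d + 1) \<le> \<epsilon> * r"
        using rr0 eps0 unfolding r0_def by (simp add: pos_divide_le_eq mult.commute)
      ultimately show False using an by simp
    qed
    have n2: "card P \<ge> 2"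
    proof -
      have "2 \<le> r0" by (rule r0)
      also have "r0 \<le> r0 ^ ?d" using r0 assms(1) by (intro self_le_power) auto
      also have "\<dots> \<le> real n" using False by simp
      finally show ?thesis using card by simp
    qed
    obtain m where m: "m > 0" "\<And>p q. p \<in> P \<Longrightarrow> q \<in> P \<Longrightarrow> p \<noteq> q \<Longrightarrow> m \<le> dist p q"
      "\<And>p q. p \<in> P \<Longrightarrow> q \<in> P \<Longrightarrow> dist p q \<le> \<alpha> * r * m"
      using normalized_diameter_bounds[OF fin n2 diam] unfolding r_def by metis
    obtain p0 where p0: "p0 \<in> P" using card n0 by fastforce
    \<comment> \<open>Scaling by the minimal distance makes the image \<open>1\<close>-separated,
      and \<open>p0\<close> goes to the origin. The form translation plus multiple fits
      \<open>convex_hull_affinity\<close>.\<close>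
    define g where "g x = - ((1 / m) *\<^sub>R p0) + (1 / m) *\<^sub>R x" for x :: "real^'d"
    have dg: "dist (g x) (g y) = dist x y / m" for x y
      using m(1) by (simp add: g_def dist_norm scaleR_diff_right[symmetric] divide_inverse)
    have injg: "inj g"
      by (rule injI) (use dg m(1) in \<open>metis dist_eq_0_iff divide_eq_0_iff less_irrefl\<close>)
    obtain Q' where Q': "Q' \<subseteq> g ` P" "\<forall>q\<in>Q'. q \<notin> convex hull (Q' - {q})"
      "real (card Q') \<ge> b * (r / (6 * ?D * a)) ^ (?d - 1)"
      unfolding b_def
    proof (rule large_convex_subset_of_separated_set[OF assms(1) r a, of \<alpha> "g ` P" \<epsilon>])
      show "1 \<le> dist p q" if "p \<in> g ` P" "q \<in> g ` P" "p \<noteq> q" for p q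
      proof -
        obtain x y where "x \<in> P" "y \<in> P" "p = g x" "q = g y" using \<open>p \<in> g ` P\<close> \<open>q \<in> g ` P\<close> by blast
        then show ?thesis using m(1) m(2)[of x y] \<open>p \<noteq> q\<close> by (auto simp: dg pos_le_divide_eq)
      qed
      show "norm p \<le> \<alpha> * r" if p: "p \<in> g ` P" for p
      proof -
        obtain x where x: "x \<in> P" "p = g x" using p by blast
        have "g p0 = 0" by (simp add: g_def)
        then have "norm p = dist x p0 / m" using dg[of x p0] x by simp
        then show ?thesis using m(1) m(3)[OF x(1) p0] by (simp add: pos_divide_le_eq)
      qed
      show "real (card (g ` P)) = r ^ ?d" using card rn injg by (simp add: card_image inj_on_subset)
      show "\<epsilon> * (48 * ?D * (5 * ?D) ^ ?d * (16 * ?D) ^ (?d - 1)) \<le> 1 / (12 * ?D)"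
        unfolding c_def[symmetric] \<epsilon>_def using c1 by simp
    qed (use assms(2) fin p0 an eps1 large in auto)
    \<comment> \<open>Hull avoidance is pulled back along the affine injection \<open>g\<close>,
      while general position is inherited directly from \<open>P\<close>.\<close>
    define Q where "Q = {p \<in> P. g p \<in> Q'}"
    have gQ: "g ` Q = Q'" using Q'(1) by (auto simp: Q_def)
    have cQ: "card Q = card Q'" unfolding gQ[symmetric] using injg by (simp add: card_image inj_on_subset)
    have "convex_independent Q"
      unfolding convex_independent_def
    proof (intro conjI ballI notI)
      show "finite Q" using fin by (simp add: Q_def)
      show "general_position Q" using gp by (rule general_position_subset) (simp add: Q_def)
      fix q assume q: "q \<in> Q" "q \<in> convex hull (Q - {q})"
      have "g ` (Q - {q}) = Q' - {g q}" using injg gQ by (auto simp: inj_def)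
      moreover have "g q \<in> convex hull (g ` (Q - {q}))"
        unfolding g_def convex_hull_affinity using q(2) by (rule imageI)
      ultimately show False using Q'(2) gQ q(1) by auto
    qed
    moreover have "\<beta> * real n powr \<gamma> \<le> real (card Q)"
    proof -
      \<comment> \<open>Comparing powers of exponent \<open>d + 1\<close> gives
        \<open>s * a \<le> r\<close>, because
        \<open>(s * a) ^ (d + 1) = n * \<epsilon> * r \<le> r ^ (d + 1)\<close>. Hence
        \<open>r / a\<close> is at least \<open>s\<close>, whose power of exponent
        \<open>d - 1\<close> is the required growth.\<close>
      define s where "s = real n powr (1 / (?D + 1))"
      have s_pow: "s ^ k = real n powr (real k / (?D + 1))" for k
        unfolding s_def using n0 by (simp add: powr_powr powr_realpow[symmetric])
      have "(s * a) ^ (?d + 1) = real n * (\<epsilon> * r)"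
        unfolding power_mult_distrib an s_pow using n0 by (simp add: add.commute)
      also have "\<dots> \<le> real n * r" using eps1 r by (intro mult_left_mono) auto
      also have "\<dots> = r ^ (?d + 1)" by (simp add: rn mult.commute)
      finally have "s * a \<le> r"
        by (rule power_le_imp_le_base[of "s * a" ?d r, unfolded Suc_eq_plus1]) (use r in simp)
      then have "s \<le> r / a" using a by (simp add: pos_le_divide_eq)
      then have "s ^ (?d - 1) \<le> (r / a) ^ (?d - 1)" by (intro power_mono) (auto simp: s_def)
      moreover have "s ^ (?d - 1) = real n powr \<gamma>" unfolding s_pow \<gamma>_def using assms(1) by (simp add: of_nat_diff)
      ultimately have "real n powr \<gamma> \<le> (r / a) ^ (?d - 1)" by simp
      then have "\<beta> * real n powr \<gamma> \<le> b * (1 / (6 * ?D)) ^ (?d - 1) * (r / a) ^ (?d - 1)"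
        using b0 D by (intro mult_mono) (auto simp: \<beta>_def)
      also have "\<dots> = b * (r / (6 * ?D * a)) ^ (?d - 1)"
        by (simp add: power_mult_distrib[symmetric])
      finally show ?thesis using Q'(3) cQ by simp
    qed
    ultimately show ?thesis by (intro exI[of _ Q]) (simp add: Q_def)
  qed
  then show ?thesis using beta0 unfolding \<gamma>_def by blast
qed

end
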